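(* Let $r>6$ and $n$ be integers with $3r+3\le n\le r^2$, and put $a=n-2r+1$ and $b=2r-1$. Suppose $a=2m\ge r+8$ is an even integer and $k$ is any integer with $1\le k\le 5$. Let $D_{2m}=\langle \rho,\sigma : \rho^m=\sigma^2=1,\ \sigma\rho\sigma=\rho^{-1}\rangle$ be the dihedral group of order $2m$ with identity $e$, let $R=\{\rho^j:0\le j\le m-1\}$ and $R\sigma=\{\rho^j\sigma:0\le j\le m-1\}$, and let $F\subseteq R\sigma$ satisfy $|F|=m-k$. If $S=(R\setminus\{e\})\cup F$ is a generating set of $D_{2m}$, then the Cayley graph $X=\mathrm{Cay}(D_{2m},S)$ satisfies: (i) $\alpha(X)\le r-1$; (ii) $\kappa(X)\ge a-b$; (iii) $\Delta(X)\ge r+2$.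
   Context: For a finite group $\Gamma$ with identity $e$ and an inverse-closed subset $S\subseteq\Gamma\setminus\{e\}$, the undirected Cayley graph $\mathrm{Cay}(\Gamma,S)$ has vertex set $\Gamma$, with $u$ and $v$ adjacent if and only if $uv^{-1}\in S$. $\alpha(X)$ is the maximum size of an independent set of $X$ and $\Delta(X)$ is the maximum degree. A graph is $k$-connected if it has at least $k+1$ vertices and removal of any $k-1$ or fewer vertices leaves a connected graph; $\kappa(X)$ is the largest $k$ for which $X$ is $k$-connected. *)

theory Defs
  imports "HOL-Algebra.Generated_Groups" "Graph_Theory.Digraph_Component"
begin

section \<open>Dihedral groups\<close>

text \<open>
  \<open>G\<close> is generated by \<open>\<rho>\<close> and \<open>\<sigma>\<close>, these satisfy the defining relations, and \<open>G\<close> has order \<open>2m\<close>.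
  Since the group presented by the relations has order \<open>2m\<close>, this says that \<open>G\<close> is that group,
  with \<open>\<rho>\<close>, \<open>\<sigma>\<close> as its distinguished generators: \<open>presentation\<close> below derives the universal
  property of the presentation, and \<open>dihedral_model\<close> shows existence for every \<open>m\<close>.
\<close>

locale dihedral_group = group G for G (structure) +
  fixes m :: nat and \<rho> \<sigma>
  assumes m_pos: "0 < m"
    and rho_closed: "\<rho> \<in> carrier G"
    and sigma_closed: "\<sigma> \<in> carrier G"
    and rho_pow: "\<rho> [^] m = \<one>"
    and sigma_sq: "\<sigma> [^] (2::nat) = \<one>"
    and sigma_rho_sigma: "\<sigma> \<otimes> \<rho> \<otimes> \<sigma> = inv \<rho>"
    and generated: "generate G {\<rho>, \<sigma>} = carrier G"
    and order_eq: "order G = 2 * m"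

text \<open>The relations alone already fix how products of normal forms are computed.\<close>

lemma dihedral_relations_commute:
  fixes H (structure) and m j :: nat
  assumes "group H" "x \<in> carrier H" "y \<in> carrier H" "0 < m"
    and xm: "x [^] m = \<one>" and y2: "y [^] (2::nat) = \<one>" and yxy: "y \<otimes> x \<otimes> y = inv x"
    and "j \<le> m"
  shows "y \<otimes> x [^] j = x [^] (m - j) \<otimes> y"
proof -
  interpret group H by fact
  have yy: "y \<otimes> y = \<one>" using y2 assms(3) by (simp add: numeral_2_eq_2)
  have yx: "y \<otimes> x = inv x \<otimes> y"
    by (metis assms(2,3) yxy yy inv_closed m_assoc m_closed r_one)
  have *: "y \<otimes> x [^] i = inv (x [^] i) \<otimes> y" for i :: nat
  proof (induction i)
    case (Suc i)
    have "y \<otimes> x [^] Suc i = (y \<otimes> x [^] i) \<otimes> x" using assms(2,3) by (simp add: m_assoc)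
    also have "\<dots> = inv (x [^] i) \<otimes> (y \<otimes> x)" using Suc assms(2,3) by (simp add: m_assoc)
    also have "\<dots> = inv (x [^] i) \<otimes> inv x \<otimes> y" using yx assms(2,3) by (simp add: m_assoc)
    also have "\<dots> = inv (x \<otimes> x [^] i) \<otimes> y" using assms(2) by (simp add: inv_mult_group)
    also have "x \<otimes> x [^] i = x [^] Suc i" using assms(2) nat_pow_Suc2 by metis
    finally show ?case .
  qed (use assms(3) in simp)
  have "x [^] (m - j) \<otimes> x [^] j = \<one>"
    using xm assms(2) \<open>j \<le> m\<close> by (simp add: nat_pow_mult)
  then have "inv (x [^] j) = x [^] (m - j)"
    using assms(2) by (simp add: inv_equality)
  with * show ?thesis by simp
qed

definition dihedral_word :: "('a, 'b) monoid_scheme \<Rightarrow> 'a \<Rightarrow> 'a \<Rightarrow> nat \<times> nat \<Rightarrow> 'a" where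
  "dihedral_word H x y = (\<lambda>(i, e). x [^]\<^bsub>H\<^esub> i \<otimes>\<^bsub>H\<^esub> y [^]\<^bsub>H\<^esub> e)"

definition dihedral_word_mult :: "nat \<Rightarrow> nat \<times> nat \<Rightarrow> nat \<times> nat \<Rightarrow> nat \<times> nat" where
  "dihedral_word_mult m = (\<lambda>(i, e) (j, f).
     ((if e = 0 then i + j else i + (m - j)) mod m, (e + f) mod 2))"

lemma dihedral_word_mult:
  fixes H (structure) and m :: nat
  assumes "group H" "x \<in> carrier H" "y \<in> carrier H" "0 < m"
    and xm: "x [^] m = \<one>" and y2: "y [^] (2::nat) = \<one>" and yxy: "y \<otimes> x \<otimes> y = inv x"
    and p: "p \<in> {..<m} \<times> {..<2}" and q: "q \<in> {..<m} \<times> {..<2}"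
  shows "dihedral_word H x y p \<otimes> dihedral_word H x y q
           = dihedral_word H x y (dihedral_word_mult m p q)"
proof -
  interpret group H by fact
  obtain i e j f where pq: "p = (i, e)" "q = (j, f)" by fastforce
  have red: "z [^] (k mod l) = z [^] k" if "z \<in> carrier H" "z [^] l = \<one>" for z and k l :: nat
  proof -
    have "z [^] k = z [^] (l * (k div l) + k mod l)" by simp
    also have "\<dots> = (z [^] l) [^] (k div l) \<otimes> z [^] (k mod l)"
      using that(1) by (simp only: nat_pow_mult nat_pow_pow)
    finally show ?thesis using that by simp
  qed
  have comm: "y [^] e \<otimes> x [^] j = x [^] (if e = 0 then j else m - j) \<otimes> y [^] e"
  proof (cases "e = 0")
    case False
    then have "e = 1" using p pq by auto
    then show ?thesis
      using dihedral_relations_commute[OF assms(1-7), of j] q pq assms(3) by simp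
  qed (use assms(2) in simp)
  have "x [^] i \<otimes> y [^] e \<otimes> (x [^] j \<otimes> y [^] f)
      = x [^] i \<otimes> (y [^] e \<otimes> x [^] j) \<otimes> y [^] f"
    using assms(2,3) by (simp add: m_assoc)
  also have "\<dots> = (x [^] i \<otimes> x [^] (if e = 0 then j else m - j)) \<otimes> (y [^] e \<otimes> y [^] f)"
    unfolding comm using assms(2,3) by (simp add: m_assoc del: if_split)
  also have "\<dots> = x [^] (i + (if e = 0 then j else m - j)) \<otimes> y [^] (e + f)"
    using assms(2,3) by (simp only: nat_pow_mult)
  also have "\<dots> = x [^] ((i + (if e = 0 then j else m - j)) mod m) \<otimes> y [^] ((e + f) mod 2)"
    using red[OF assms(2) xm] red[OF assms(3) y2] by (simp only:)
  finally show ?thesis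
    by (simp add: pq dihedral_word_def dihedral_word_mult_def if_distrib)
qed

lemma (in dihedral_group) bij_betw_dihedral_word:
  "bij_betw (dihedral_word G \<rho> \<sigma>) ({..<m} \<times> {..<2}) (carrier G)"
proof -
  let ?I = "{..<m} \<times> {..<2::nat}" and ?w = "dihedral_word G \<rho> \<sigma>"
  note rel = is_group rho_closed sigma_closed m_pos rho_pow sigma_sq sigma_rho_sigma
  have closed: "?w ` ?I \<subseteq> carrier G"
    using rho_closed sigma_closed by (auto simp: dihedral_word_def)
  have mult: "a \<otimes> b \<in> ?w ` ?I" if "a \<in> ?w ` ?I" "b \<in> ?w ` ?I" for a b
  proof -
    obtain p q where "p \<in> ?I" "q \<in> ?I" "a = ?w p" "b = ?w q" using \<open>a \<in> _\<close> \<open>b \<in> _\<close> by blast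
    moreover have "dihedral_word_mult m p q \<in> ?I"
      using m_pos by (auto simp: dihedral_word_mult_def split: prod.splits)
    ultimately show ?thesis using dihedral_word_mult[OF rel] by (metis imageI)
  qed
  have one: "\<one> \<in> ?w ` ?I"
    using m_pos by (intro image_eqI[of _ _ "(0, 0)"]) (auto simp: dihedral_word_def)
  have sigma: "\<sigma> \<in> ?w ` ?I"
    using m_pos sigma_closed by (intro image_eqI[of _ _ "(0, 1)"]) (auto simp: dihedral_word_def)
  have pow: "\<rho> [^] i \<in> ?w ` ?I" if "i < m" for i
    using that rho_closed by (intro image_eqI[of _ _ "(i, 0)"]) (auto simp: dihedral_word_def)
  have rho: "\<rho> \<in> ?w ` ?I"
  proof (cases "m = 1")
    case True
    then show ?thesis using one rho_pow rho_closed by simp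
  next
    case False
    then show ?thesis using pow[of 1] m_pos rho_closed by simp
  qed
  have "inv \<rho> = \<rho> [^] (m - 1)"
  proof (rule inv_equality)
    show "\<rho> [^] (m - 1) \<otimes> \<rho> = \<one>"
      using rho_pow m_pos nat_pow_Suc[of \<rho> "m - 1"] by simp
  qed (use rho_closed in auto)
  then have inv_rho: "inv \<rho> \<in> ?w ` ?I" using pow[of "m - 1"] m_pos by simp
  have "inv \<sigma> = \<sigma>"
    using sigma_sq sigma_closed by (intro inv_equality) (auto simp: numeral_2_eq_2)
  then have inv_sigma: "inv \<sigma> \<in> ?w ` ?I" using sigma by simp
  have "a \<in> ?w ` ?I" if "a \<in> generate G {\<rho>, \<sigma>}" for a
    using that by (induction rule: generate.induct)
      (use one rho sigma inv_rho inv_sigma mult in auto)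
  then have surj: "?w ` ?I = carrier G" using closed generated by auto
  moreover have "card ?I = card (carrier G)" using order_eq by (simp add: order_def)
  ultimately have "inj_on ?w ?I" by (intro eq_card_imp_inj_on) auto
  with surj show ?thesis by (simp add: bij_betw_def)
qed

theorem (in dihedral_group) presentation:
  assumes "group H" "x \<in> carrier H" "y \<in> carrier H"
    and "x [^]\<^bsub>H\<^esub> m = \<one>\<^bsub>H\<^esub>" "y [^]\<^bsub>H\<^esub> (2::nat) = \<one>\<^bsub>H\<^esub>" "y \<otimes>\<^bsub>H\<^esub> x \<otimes>\<^bsub>H\<^esub> y = inv\<^bsub>H\<^esub> x"
  shows "\<exists>h \<in> hom G H. h \<rho> = x \<and> h \<sigma> = y"
proof -
  interpret H: group H by fact
  let ?I = "{..<m} \<times> {..<2::nat}" and ?w = "dihedral_word G \<rho> \<sigma>" and ?v = "dihedral_word H x y"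
  note rel = is_group rho_closed sigma_closed m_pos rho_pow sigma_sq sigma_rho_sigma
  note relH = assms(1-3) m_pos assms(4-6)
  note bij = bij_betw_dihedral_word
  define h where "h = ?v \<circ> inv_into ?I ?w"
  have h: "h (?w p) = ?v p" if "p \<in> ?I" for p
    using that bij by (simp add: h_def bij_betw_def)
  have "h \<in> hom G H"
  proof (rule homI)
    fix a assume "a \<in> carrier G"
    then obtain p where "p \<in> ?I" "a = ?w p" using bij by (metis bij_betw_def imageE)
    then show "h a \<in> carrier H"
      using h assms(2,3) by (auto simp: dihedral_word_def split: prod.splits)
  next
    fix a b assume "a \<in> carrier G" "b \<in> carrier G"
    then have "a \<in> ?w ` ?I" "b \<in> ?w ` ?I" using bij by (simp_all add: bij_betw_def)
    then obtain p q where pq: "p \<in> ?I" "a = ?w p" "q \<in> ?I" "b = ?w q" by blast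
    have "dihedral_word_mult m p q \<in> ?I"
      using m_pos by (auto simp: dihedral_word_mult_def split: prod.splits)
    then show "h (a \<otimes> b) = h a \<otimes>\<^bsub>H\<^esub> h b"
      using dihedral_word_mult[OF rel pq(1,3)] dihedral_word_mult[OF relH pq(1,3)] pq h by simp
  qed
  moreover have "h \<sigma> = y"
    using h[of "(0, 1)"] m_pos sigma_closed assms(3) by (simp add: dihedral_word_def)
  moreover have "h \<rho> = x"
  proof (cases "m = 1")
    case True
    then show ?thesis
      using h[of "(0, 0)"] rho_pow rho_closed assms(2,4) by (simp add: dihedral_word_def)
  next
    case False
    then show ?thesis
      using h[of "(1, 0)"] m_pos rho_closed assms(2) by (simp add: dihedral_word_def)
  qed
  ultimately show ?thesis by blast
qed

text \<open>In the model, \<open>(i, s)\<close> stands for \<open>\<rho>\<^sup>i\<close> if \<open>s\<close> is false and for \<open>\<rho>\<^sup>i \<sigma>\<close> otherwise.\<close>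

definition dihedral_model :: "nat \<Rightarrow> (int \<times> bool) monoid" where
  "dihedral_model m = \<lparr> carrier = {0..<int m} \<times> UNIV,
     monoid.mult = (\<lambda>(i, s) (j, t). ((if s then i - j else i + j) mod int m, s \<noteq> t)),
     one = (0, False) \<rparr>"

theorem dihedral_model:
  assumes "0 < m"
  shows "dihedral_group (dihedral_model m) m (1 mod int m, False) (0, True)"
proof -
  let ?D = "dihedral_model m" and ?r = "(1 mod int m, False)" and ?s = "(0::int, True)"
  have D: "carrier ?D = {0..<int m} \<times> UNIV" "\<one>\<^bsub>?D\<^esub> = (0, False)"
    "(i, s) \<otimes>\<^bsub>?D\<^esub> (j, t) = ((if s then i - j else i + j) mod int m, s \<noteq> t)" for i j s t
    by (simp_all add: dihedral_model_def)
  interpret group ?D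
  proof (rule groupI)
    fix x y z assume "x \<in> carrier ?D" "y \<in> carrier ?D" "z \<in> carrier ?D"
    then show "x \<otimes>\<^bsub>?D\<^esub> y \<otimes>\<^bsub>?D\<^esub> z = x \<otimes>\<^bsub>?D\<^esub> (y \<otimes>\<^bsub>?D\<^esub> z)"
      by (cases x; cases y; cases z) (auto simp: D mod_simps algebra_simps)
  next
    fix x assume "x \<in> carrier ?D"
    then obtain i s where x: "x = (i, s)" "0 \<le> i" "i < int m" by (cases x) (auto simp: D)
    show "\<exists>y\<in>carrier ?D. y \<otimes>\<^bsub>?D\<^esub> x = \<one>\<^bsub>?D\<^esub>"
      by (rule bexI[of _ "(if s then i else - i mod int m, s)"])
        (use x assms in \<open>auto simp: D mod_simps\<close>)
  qed (use assms in \<open>auto simp: D split: if_splits\<close>)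
  have r: "?r \<in> carrier ?D" and s: "?s \<in> carrier ?D" using assms by (auto simp: D)
  have pow: "?r [^]\<^bsub>?D\<^esub> k = (int k mod int m, False)" for k :: nat
    by (induction k) (auto simp: D mod_simps algebra_simps)
  have "?s \<otimes>\<^bsub>?D\<^esub> ?r \<otimes>\<^bsub>?D\<^esub> ?s = inv\<^bsub>?D\<^esub> ?r"
    by (rule inv_equality[symmetric]) (use r s assms in \<open>auto simp: D mod_simps\<close>)
  moreover have "?s [^]\<^bsub>?D\<^esub> (2::nat) = \<one>\<^bsub>?D\<^esub>"
    by (simp add: numeral_2_eq_2 D)
  moreover have "generate ?D {?r, ?s} = carrier ?D"
  proof
    show "generate ?D {?r, ?s} \<subseteq> carrier ?D" using generate_incl r s by simp
    interpret U: subgroup "generate ?D {?r, ?s}" ?D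
      using generate_is_subgroup r s by simp
    have powin: "?r [^]\<^bsub>?D\<^esub> k \<in> generate ?D {?r, ?s}" for k :: nat
      by (induction k) (auto intro: U.m_closed generate.incl)
    show "carrier ?D \<subseteq> generate ?D {?r, ?s}"
    proof
      fix x assume "x \<in> carrier ?D"
      then obtain i t where x: "x = (i, t)" "0 \<le> i" "i < int m" by (cases x) (auto simp: D)
      then have "?r [^]\<^bsub>?D\<^esub> nat i = (i, False)" by (simp add: pow)
      with powin[of "nat i"] have i: "(i, False) \<in> generate ?D {?r, ?s}" by simp
      moreover have "(i, False) \<otimes>\<^bsub>?D\<^esub> ?s \<in> generate ?D {?r, ?s}"
        by (intro U.m_closed i generate.incl) simp
      ultimately show "x \<in> generate ?D {?r, ?s}" using x by (cases t) (auto simp: D)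
    qed
  qed
  moreover have "order ?D = 2 * m"
    by (simp add: order_def D card_cartesian_product)
  ultimately show ?thesis
    using assms r s pow[of m] by unfold_locales (auto simp: D)
qed


section \<open>Cayley graphs\<close>

text \<open>Undirected graphs are symmetric loop-free pair digraphs, as in \<open>Graph_Theory\<close>.\<close>

definition Cay :: "('a, 'b) monoid_scheme \<Rightarrow> 'a set \<Rightarrow> 'a pair_pre_digraph" where
  "Cay G S = \<lparr> pverts = carrier G,
     parcs = {(u, v). u \<in> carrier G \<and> v \<in> carrier G \<and> u \<otimes>\<^bsub>G\<^esub> inv\<^bsub>G\<^esub> v \<in> S} \<rparr>"

lemma pair_graph_Cay:
  assumes "group G" "finite (carrier G)" "S \<subseteq> carrier G - {\<one>\<^bsub>G\<^esub>}"
    and "\<And>s. s \<in> S \<Longrightarrow> inv\<^bsub>G\<^esub> s \<in> S"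
  shows "pair_graph (Cay G S)"
proof -
  interpret group G by fact
  have sub: "parcs (Cay G S) \<subseteq> carrier G \<times> carrier G" by (auto simp: Cay_def)
  have "(v, u) \<in> parcs (Cay G S)" if "(u, v) \<in> parcs (Cay G S)" for u v
    using that assms(4)[of "u \<otimes>\<^bsub>G\<^esub> inv\<^bsub>G\<^esub> v"] by (auto simp: Cay_def inv_mult_group)
  then have "symmetric (Cay G S)" by (auto simp: symmetric_def intro: symI)
  moreover have "fst e \<noteq> snd e" if "e \<in> parcs (Cay G S)" for e
    using that assms(3) by (auto simp: Cay_def)
  moreover have "finite (parcs (Cay G S))"
    using sub assms(2) finite_subset by blast
  ultimately show ?thesis
    using assms(2) sub by unfold_locales (auto simp: Cay_def)
qed


section \<open>Graph invariants\<close>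

definition independent_set :: "'a pair_pre_digraph \<Rightarrow> 'a set \<Rightarrow> bool" where
  "independent_set X I \<longleftrightarrow> I \<subseteq> pverts X \<and> (\<forall>u\<in>I. \<forall>v\<in>I. (u, v) \<notin> parcs X)"

definition independence_number :: "'a pair_pre_digraph \<Rightarrow> nat" where
  "independence_number X = Max {card I | I. independent_set X I}"

text \<open>In a symmetric digraph the out-degree of a vertex is its number of neighbours.\<close>

definition max_degree :: "'a pair_pre_digraph \<Rightarrow> nat" where
  "max_degree X = Max (out_degree (with_proj X) ` pverts X)"

definition k_connected :: "nat \<Rightarrow> 'a pair_pre_digraph \<Rightarrow> bool" where
  "k_connected k X \<longleftrightarrow> k + 1 \<le> card (pverts X) \<and>
     (\<forall>W \<subseteq> pverts X. card W < k \<longrightarrow>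
        Digraph_Component.connected (with_proj X \<restriction> (pverts X - W)))"

definition vertex_connectivity :: "'a pair_pre_digraph \<Rightarrow> nat" where
  "vertex_connectivity X = Max {k. k_connected k X}"

end

theory Submission
  imports Defs
begin

text \<open>
  The rotations form a subgroup \<open>H\<close> of index two, \<open>S\<close> contains every non-identity rotation,
  and \<open>F\<close> lies in the other coset. Two distinct vertices of the same coset of \<open>H\<close> have their
  quotient in \<open>H\<close>, so the graph consists of two cliques on \<open>card H\<close> vertices, and the elements of \<open>F\<close> join every vertex to exactly \<open>card F\<close> vertices
  of the other clique. The three invariants can be read off from this picture.

  An independent set meets each clique at most once, so it has at most two vertices
  (\<open>independence_number_le\<close>). Every vertex has \<open>card H - 1 + card F\<close> neighbours
  (\<open>max_degree_eq\<close>). Finally, suppose that deleting some vertices disconnects the graph. What is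
  left of each clique is connected, so both cliques leave a nonempty remainder and no edge joins
  the two remainders. A surviving vertex of one clique is non-adjacent to only
  \<open>card H - card F\<close> vertices of the other, so each remainder has at most that many vertices and at least \<open>2 * card F\<close>
  vertices have been deleted (\<open>k_connected_twice_card\<close>).

  For the dihedral group, \<open>card H = m\<close> and \<open>card F = m - k\<close>, so the degree is
  \<open>2 * m - 1 - k \<ge> r + 2\<close>, as \<open>2 * m \<ge> r + 8\<close> and \<open>k \<le> 5\<close>. The connectivity is at least
  \<open>2 * m - 2 * k \<ge> 2 * m - 10 \<ge> 2 * m - (2 * r - 1)\<close>, as \<open>k \<le> 5\<close> and \<open>r > 6\<close>.
\<close>

section \<open>Cayley graphs made of two joined cliques\<close>

locale two_clique_cayley = group G for G (structure) +
  fixes H F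
  assumes subgroup_H: "subgroup H G"
    and finite_carrier: "finite (carrier G)"
    and index_two: "order G = 2 * card H"
    and F_subset: "F \<subseteq> carrier G - H"
begin

abbreviation connection_set where "connection_set \<equiv> (H - {\<one>}) \<union> F"

abbreviation graph where "graph \<equiv> Cay G connection_set"

lemma H_subset: "H \<subseteq> carrier G"
  using subgroup_H by (rule subgroup.subset)

lemma finite_H: "finite H" and finite_F: "finite F"
  using H_subset F_subset finite_carrier by (auto intro: finite_subset)

lemma card_H_pos: "0 < card H"
  using subgroup.finite_imp_card_positive[OF subgroup_H finite_carrier] .

lemma card_complement: "card (carrier G - H) = card H"
  using index_two card_Diff_subset[OF finite_H H_subset] by (simp add: order_def)

text \<open>
  For \<open>u\<close> and \<open>v\<close> outside \<open>H\<close>, the coset \<open>H #> v\<close> is disjoint from \<open>H\<close> and already as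
  large as the whole complement of \<open>H\<close>, so it contains \<open>u\<close>.
\<close>

lemma quotient_in_H:
  assumes u: "u \<in> carrier G" and v: "v \<in> carrier G" and same: "u \<in> H \<longleftrightarrow> v \<in> H"
  shows "u \<otimes> inv v \<in> H"
proof (cases "v \<in> H")
  case True
  then show ?thesis
    using same subgroup_H by (simp add: subgroup.m_closed subgroup.m_inv_closed)
next
  case False
  have coset: "H #> v \<in> rcosets H"
    using v by (auto simp: RCOSETS_def)
  have "h \<otimes> v \<notin> H" if "h \<in> H" for h
  proof
    assume "h \<otimes> v \<in> H"
    then have "inv h \<otimes> (h \<otimes> v) \<in> H"
      using that subgroup_H by (simp add: subgroup.m_closed subgroup.m_inv_closed)
    moreover have "inv h \<otimes> (h \<otimes> v) = v"
      using that v H_subset by (simp add: m_assoc[symmetric] subset_iff)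
    ultimately show False using False by simp
  qed
  then have "H #> v \<subseteq> carrier G - H"
    using v H_subset by (auto simp: r_coset_def)
  moreover have "card (H #> v) = card (carrier G - H)"
    using card_rcosets_equal[OF coset H_subset] card_complement by simp
  ultimately have "H #> v = carrier G - H"
    using finite_carrier by (intro card_subset_eq) auto
  then have "u \<in> H #> v" using u same False by simp
  then show ?thesis
    using subgroup.rcos_module[OF subgroup_H is_group v u] by simp
qed

lemma pverts_graph: "pverts graph = carrier G"
  by (simp add: Cay_def)

lemma parcs_graph_iff:
  "(u, v) \<in> parcs graph \<longleftrightarrow> u \<in> carrier G \<and> v \<in> carrier G \<and> u \<otimes> inv v \<in> connection_set"
  by (simp add: Cay_def)

lemma clique:
  assumes "u \<in> carrier G" "v \<in> carrier G" "u \<in> H \<longleftrightarrow> v \<in> H" "u \<noteq> v"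
  shows "(u, v) \<in> parcs graph"
proof -
  have "u \<otimes> inv v \<noteq> \<one>"
    using assms by (metis inv_closed inv_equality inv_inv)
  then show ?thesis
    using assms quotient_in_H by (simp add: parcs_graph_iff)
qed

text \<open>
  The neighbours of \<open>v\<close> in the clique that does not contain it are the translates \<open>f \<otimes> v\<close>
  with \<open>f \<in> F\<close>, so \<open>C\<close> has to fit into the rest of that clique.
\<close>

lemma card_nonadjacent_le:
  assumes v: "v \<in> carrier G" and C: "C \<subseteq> carrier G"
    and opposite: "\<And>u. u \<in> C \<Longrightarrow> u \<in> H \<longleftrightarrow> v \<notin> H"
    and nonadjacent: "\<And>u. u \<in> C \<Longrightarrow> (u, v) \<notin> parcs graph"
  shows "card C + card F \<le> card H"
proof -
  define N where "N = (\<lambda>f. f \<otimes> v) ` F"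
  have FG: "F \<subseteq> carrier G" using F_subset by blast
  have card_N: "card N = card F"
    unfolding N_def using v FG by (intro card_image inj_onI) (auto simp: subset_iff)
  have quotient: "f \<otimes> v \<otimes> inv v = f" if "f \<in> F" for f
    using that FG v by (simp add: m_assoc subset_iff)
  have N_opposite: "u \<in> H \<longleftrightarrow> v \<notin> H" if "u \<in> N" for u
  proof (rule ccontr)
    assume "\<not> (u \<in> H \<longleftrightarrow> v \<notin> H)"
    moreover have "u \<in> carrier G" using that v FG by (auto simp: N_def)
    ultimately have "u \<otimes> inv v \<in> H" using quotient_in_H v by blast
    then show False using that quotient F_subset by (auto simp: N_def)
  qed
  have N_adjacent: "(u, v) \<in> parcs graph" if "u \<in> N" for u
    using that quotient v FG by (auto simp: N_def parcs_graph_iff)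
  let ?opp = "if v \<in> H then carrier G - H else H"
  have "C \<union> N \<subseteq> ?opp"
    using C opposite N_opposite v FG by (auto simp: N_def)
  moreover have "card ?opp = card H" "finite ?opp"
    using card_complement finite_carrier finite_H by simp_all
  ultimately have "card (C \<union> N) \<le> card H" by (metis card_mono)
  moreover have "card (C \<union> N) = card C + card N"
  proof (rule card_Un_disjoint)
    show "finite C" using C finite_carrier by (rule finite_subset)
    show "finite N" using finite_F by (simp add: N_def)
    show "C \<inter> N = {}" using nonadjacent N_adjacent by blast
  qed
  ultimately show ?thesis using card_N by simp
qed

section \<open>Independence number and degree\<close>

lemma independence_number_le: "independence_number graph \<le> 2"
proof -
  have bound: "card I \<le> 2" if "independent_set graph I" for I
  proof -
    have I: "I \<subseteq> carrier G" and free: "\<And>u v. u \<in> I \<Longrightarrow> v \<in> I \<Longrightarrow> (u, v) \<notin> parcs graph"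
      using that by (auto simp: independent_set_def pverts_graph)
    have "u = v" if "u \<in> I" "v \<in> I" "u \<in> H \<longleftrightarrow> v \<in> H" for u v
      using that clique free I by blast
    then have "inj_on (\<lambda>u. u \<in> H) I" by (rule inj_onI)
    then have "card I \<le> card (UNIV :: bool set)" by (rule card_inj_on_le) auto
    then show ?thesis by simp
  qed
  have "independent_set graph {}" by (simp add: independent_set_def)
  moreover have "{card I | I. independent_set graph I} \<subseteq> {..2}" using bound by auto
  moreover from this have "finite {card I | I. independent_set graph I}"
    by (rule finite_subset) simp
  ultimately show ?thesis
    unfolding independence_number_def by (subst Max_le_iff) (use bound in auto)
qed

lemma out_degree_graph:
  assumes v: "v \<in> carrier G"
  shows "out_degree (with_proj graph) v = card H - 1 + card F"
proof -
  let ?S = connection_set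
  have SG: "?S \<subseteq> carrier G" using H_subset F_subset by blast
  have "out_arcs (with_proj graph) v = (\<lambda>s. (v, inv s \<otimes> v)) ` ?S"
  proof (intro equalityI subsetI)
    fix e assume "e \<in> out_arcs (with_proj graph) v"
    then obtain w where e: "e = (v, w)" "w \<in> carrier G" "v \<otimes> inv w \<in> ?S"
      by (cases e) (auto simp: out_arcs_def parcs_graph_iff)
    have "inv (v \<otimes> inv w) \<otimes> v = w"
      using v e by (simp add: inv_mult_group m_assoc)
    then show "e \<in> (\<lambda>s. (v, inv s \<otimes> v)) ` ?S"
      using e by (intro image_eqI[of _ _ "v \<otimes> inv w"]) auto
  next
    fix e assume "e \<in> (\<lambda>s. (v, inv s \<otimes> v)) ` ?S"
    then obtain s where s: "s \<in> ?S" "e = (v, inv s \<otimes> v)" by blast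
    then have sG: "s \<in> carrier G" using SG by blast
    have "v \<otimes> inv (inv s \<otimes> v) = s"
      using v sG by (simp add: inv_mult_group m_assoc[symmetric])
    then have "(v, inv s \<otimes> v) \<in> parcs graph"
      using v sG s by (simp only: parcs_graph_iff) simp
    then show "e \<in> out_arcs (with_proj graph) v"
      using s by (simp add: out_arcs_def)
  qed
  moreover have "inj_on (\<lambda>s. (v, inv s \<otimes> v)) ?S"
  proof (rule inj_onI)
    fix s t assume "s \<in> ?S" "t \<in> ?S" and eq: "(v, inv s \<otimes> v) = (v, inv t \<otimes> v)"
    then have "s \<in> carrier G" "t \<in> carrier G" using SG by blast+
    then show "s = t" using eq v by (metis inv_closed inv_inv prod.inject right_cancel)
  qed
  ultimately have "out_degree (with_proj graph) v = card ?S"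
    by (simp add: out_degree_def card_image)
  also have "\<dots> = card (H - {\<one>}) + card F"
    using F_subset finite_H finite_F by (intro card_Un_disjoint) auto
  finally show ?thesis
    using subgroup.one_closed[OF subgroup_H] by simp
qed

lemma max_degree_eq: "max_degree graph = card H - 1 + card F"
proof -
  have "out_degree (with_proj graph) ` pverts graph = {card H - 1 + card F}"
    using out_degree_graph one_closed unfolding pverts_graph by (auto simp: image_iff)
  then show ?thesis by (simp add: max_degree_def)
qed

section \<open>Connectivity\<close>

text \<open>
  If no edge joined the remainders \<open>A\<close> and \<open>B\<close> of the two cliques, then
  \<open>card_nonadjacent_le\<close>, applied to a vertex of \<open>B\<close> and to a vertex of \<open>A\<close>, would bound each of
  their sizes by \<open>card H - card F\<close>. But more than \<open>2 * (card H - card F)\<close> vertices survive.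
\<close>

lemma connected_after_deletion:
  assumes W: "W \<subseteq> carrier G" and small: "card W < 2 * card F"
  shows "Digraph_Component.connected (with_proj graph \<restriction> (pverts graph - W))"
proof -
  define Y where "Y = carrier G - W"
  let ?K = "mk_symmetric (with_proj graph \<restriction> Y)"
  have Y: "Y \<subseteq> carrier G" "finite Y"
    using finite_carrier by (auto simp: Y_def)
  have "card Y = card (carrier G) - card W"
    unfolding Y_def using W finite_carrier by (meson card_Diff_subset finite_subset)
  then have large: "2 * card H < card Y + 2 * card F"
    using small index_two card_H_pos by (simp add: order_def)
  have pverts_K: "pverts ?K = Y" by simp
  have parcs_K: "(u, v) \<in> parcs ?K \<longleftrightarrow>
      u \<in> Y \<and> v \<in> Y \<and> ((u, v) \<in> parcs graph \<or> (v, u) \<in> parcs graph)" for u v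
    by (auto simp: parcs_mk_symmetric)
  interpret K: pair_wf_digraph ?K
    by unfold_locales (use parcs_K in auto)
  have adj: "u \<rightarrow>\<^sup>*\<^bsub>with_proj ?K\<^esub> v" if "(u, v) \<in> parcs ?K" for u v
    using that by (intro K.reachable_adjI) simp
  have same: "u \<rightarrow>\<^sup>*\<^bsub>with_proj ?K\<^esub> v" if "u \<in> Y" "v \<in> Y" "u \<in> H \<longleftrightarrow> v \<in> H" for u v
  proof (cases "u = v")
    case True
    then show ?thesis using that by (simp add: K.reachable_refl)
  next
    case False
    then show ?thesis using that Y clique by (intro adj) (auto simp: parcs_K)
  qed
  have bridge: "\<exists>x\<in>Y. \<exists>y\<in>Y. (x \<in> H \<longleftrightarrow> u \<in> H) \<and> (y \<in> H \<longleftrightarrow> v \<in> H) \<and> (x, y) \<in> parcs ?K"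
    if "u \<in> Y" "v \<in> Y" "u \<in> H \<longleftrightarrow> v \<notin> H" for u v
  proof (rule ccontr)
    assume none: "\<not> ?thesis"
    let ?A = "{x \<in> Y. x \<in> H \<longleftrightarrow> u \<in> H}" and ?B = "{y \<in> Y. y \<in> H \<longleftrightarrow> v \<in> H}"
    have "card ?A + card F \<le> card H"
      by (rule card_nonadjacent_le[of v]) (use that Y none in \<open>auto simp: parcs_K\<close>)
    moreover have "card ?B + card F \<le> card H"
      by (rule card_nonadjacent_le[of u]) (use that Y none in \<open>auto simp: parcs_K\<close>)
    moreover have "Y = ?A \<union> ?B" using that by blast
    then have "card Y \<le> card ?A + card ?B" by (metis card_Un_le)
    ultimately show False using large by simp
  qed
  have "strongly_connected (with_proj ?K)"
  proof (rule strongly_connectedI)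
    have "card F \<le> card H"
      using card_mono[OF _ F_subset] card_complement finite_carrier by simp
    then show "verts (with_proj ?K) \<noteq> {}" using large by auto
  next
    fix u v assume "u \<in> verts (with_proj ?K)" "v \<in> verts (with_proj ?K)"
    then have uv: "u \<in> Y" "v \<in> Y" by simp_all
    show "u \<rightarrow>\<^sup>*\<^bsub>with_proj ?K\<^esub> v"
    proof (cases "u \<in> H \<longleftrightarrow> v \<in> H")
      case True
      then show ?thesis using same uv by blast
    next
      case False
      then obtain x y where xy: "x \<in> Y" "y \<in> Y" "x \<in> H \<longleftrightarrow> u \<in> H" "y \<in> H \<longleftrightarrow> v \<in> H"
        "(x, y) \<in> parcs ?K"
        using bridge uv by blast
      have "u \<rightarrow>\<^sup>*\<^bsub>with_proj ?K\<^esub> x" using same xy uv by blast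
      also have "x \<rightarrow>\<^sup>*\<^bsub>with_proj ?K\<^esub> y" using adj xy by blast
      also have "y \<rightarrow>\<^sup>*\<^bsub>with_proj ?K\<^esub> v" using same xy uv by blast
      finally (K.reachable_trans) show ?thesis .
    qed
  qed
  then show ?thesis
    unfolding Digraph_Component.connected_def Y_def pverts_graph .
qed

text \<open>
  The strict inequality provides the \<open>2 * card F + 1\<close> vertices that the definition of
  \<open>2 * card F\<close>-connectedness asks for.
\<close>

lemma k_connected_twice_card:
  assumes "card F < card H"
  shows "k_connected (2 * card F) graph"
  using assms index_two connected_after_deletion
  by (simp add: k_connected_def pverts_graph order_def)

lemma vertex_connectivity_ge:
  assumes "card F < card H"
  shows "2 * card F \<le> vertex_connectivity graph"
proof -
  have "{k. k_connected k graph} \<subseteq> {..card (pverts graph)}"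
    by (auto simp: k_connected_def)
  then have "finite {k. k_connected k graph}"
    by (rule finite_subset) simp
  then show ?thesis
    unfolding vertex_connectivity_def using k_connected_twice_card[OF assms] by (intro Max_ge) auto
qed

end

section \<open>The rotations of a dihedral group\<close>

context dihedral_group
begin

abbreviation rotations where "rotations \<equiv> (\<lambda>j. \<rho> [^] j) ` {..<m}"

abbreviation reflections where "reflections \<equiv> (\<lambda>j. \<rho> [^] j \<otimes> \<sigma>) ` {..<m}"

lemma rotations_eq: "rotations = dihedral_word G \<rho> \<sigma> ` ({..<m} \<times> {0})"
  using rho_closed by (auto simp: dihedral_word_def image_iff)

lemma reflections_eq: "reflections = dihedral_word G \<rho> \<sigma> ` ({..<m} \<times> {1})"
  using sigma_closed by (auto simp: dihedral_word_def image_iff)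

lemma card_rotations: "card rotations = m"
proof -
  have "inj_on (dihedral_word G \<rho> \<sigma>) ({..<m} \<times> {0})"
    using bij_betw_imp_inj_on[OF bij_betw_dihedral_word] by (rule inj_on_subset) auto
  then show ?thesis by (simp add: rotations_eq card_image card_cartesian_product)
qed

lemma reflections_subset: "reflections \<subseteq> carrier G - rotations"
proof -
  have "dihedral_word G \<rho> \<sigma> ` ({..<m} \<times> {1}) \<inter> dihedral_word G \<rho> \<sigma> ` ({..<m} \<times> {0})
      = dihedral_word G \<rho> \<sigma> ` ({..<m} \<times> {1} \<inter> {..<m} \<times> {0})"
    using bij_betw_imp_inj_on[OF bij_betw_dihedral_word]
    by (intro inj_on_image_Int[symmetric]) auto
  also have "{..<m} \<times> {1} \<inter> {..<m} \<times> {0::nat} = {}" by auto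
  finally have "reflections \<inter> rotations = {}"
    unfolding rotations_eq reflections_eq by simp
  moreover have "reflections \<subseteq> carrier G" using rho_closed sigma_closed by auto
  ultimately show ?thesis by blast
qed

lemma subgroup_rotations: "subgroup rotations G"
proof (rule subgroupI)
  show "rotations \<subseteq> carrier G" using rho_closed by auto
  show "rotations \<noteq> {}" using m_pos by auto
next
  fix x assume "x \<in> rotations"
  then obtain i where i: "i < m" "x = \<rho> [^] i" by blast
  show "inv x \<in> rotations"
  proof (cases "i = 0")
    case True
    then have "inv x = \<rho> [^] i" using i by simp
    then show ?thesis using i by blast
  next
    case False
    have "inv x = \<rho> [^] (m - i)"
      using i rho_closed rho_pow by (intro inv_equality) (auto simp: nat_pow_mult)
    then show ?thesis using False i by auto
  qed
next
  fix x y assume "x \<in> rotations" "y \<in> rotations"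
  then obtain i j where ij: "i < m" "x = \<rho> [^] i" "j < m" "y = \<rho> [^] j" by blast
  show "x \<otimes> y \<in> rotations"
  proof (cases "i + j < m")
    case True
    then show ?thesis using ij rho_closed by (auto simp: nat_pow_mult)
  next
    case False
    have "x \<otimes> y = \<rho> [^] (m + (i + j - m))"
      using False ij rho_closed by (simp add: nat_pow_mult)
    also have "\<dots> = \<rho> [^] (i + j - m)"
      using rho_closed rho_pow by (simp add: nat_pow_mult[symmetric])
    finally show ?thesis using ij False by auto
  qed
qed

lemma two_clique_cayley_rotations:
  assumes "F \<subseteq> reflections"
  shows "two_clique_cayley G rotations F"
proof (intro two_clique_cayley.intro two_clique_cayley_axioms.intro)
  show "finite (carrier G)"
    using order_eq m_pos order_gt_0_iff_finite by simp
  show "order G = 2 * card rotations" using order_eq card_rotations by simp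
  show "F \<subseteq> carrier G - rotations"
    using assms reflections_subset by (rule subset_trans)
qed (fact is_group subgroup_rotations)+

end

section \<open>The dihedral Cayley graph\<close>

theorem proposition4p4:
  fixes r n a b k :: int and m :: nat
    and D :: "('g, 'x) monoid_scheme" and \<rho> \<sigma> :: 'g and R R\<sigma> F S :: "'g set"
    and X :: "'g pair_pre_digraph"
  assumes "r > 6" and "3 * r + 3 \<le> n" and "n \<le> r ^ 2"
    and "a = n - 2 * r + 1" and "b = 2 * r - 1"
    and "a = 2 * int m" and "a \<ge> r + 8"
    and "1 \<le> k" and "k \<le> 5"
    and "dihedral_group D m \<rho> \<sigma>"
    and "R = {\<rho> [^]\<^bsub>D\<^esub> j | j :: nat. j \<le> m - 1}"
    and "R\<sigma> = {\<rho> [^]\<^bsub>D\<^esub> j \<otimes>\<^bsub>D\<^esub> \<sigma> | j :: nat. j \<le> m - 1}"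
    and "F \<subseteq> R\<sigma>" and "int (card F) = int m - k"
    and "S = (R - {\<one>\<^bsub>D\<^esub>}) \<union> F"
    and "generate D S = carrier D"
    and "X = Cay D S"
  shows "int (independence_number X) \<le> r - 1 \<and>
         int (vertex_connectivity X) \<ge> a - b \<and>
         int (max_degree X) \<ge> r + 2"
proof -
  interpret D: dihedral_group D m \<rho> \<sigma> by fact
  have range: "{j. j \<le> m - 1} = {..<m}" using D.m_pos by auto
  have R: "R = D.rotations"
    unfolding \<open>R = _\<close> range[symmetric] by blast
  have R\<sigma>: "R\<sigma> = D.reflections"
    unfolding \<open>R\<sigma> = _\<close> range[symmetric] by blast
  interpret C: two_clique_cayley D R F
    using D.two_clique_cayley_rotations \<open>F \<subseteq> R\<sigma>\<close> unfolding R R\<sigma> by blast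
  have X: "X = C.graph" using \<open>X = Cay D S\<close> \<open>S = _\<close> by simp
  have card_R: "card R = m" using D.card_rotations R by simp
  have "card F < card R" using \<open>int (card F) = _\<close> \<open>1 \<le> k\<close> card_R by simp
  then have connectivity: "2 * card F \<le> vertex_connectivity X"
    using C.vertex_connectivity_ge X by simp
  have "int (independence_number X) \<le> r - 1"
    using C.independence_number_le \<open>r > 6\<close> X by simp
  moreover have "int (vertex_connectivity X) \<ge> a - b"
    using connectivity \<open>int (card F) = _\<close> \<open>k \<le> 5\<close> \<open>r > 6\<close> \<open>a = 2 * int m\<close> \<open>b = _\<close> by linarith
  moreover have "int (max_degree X) \<ge> r + 2"
  proof -
    have "int (max_degree X) = int m - 1 + int (card F)"
      using C.max_degree_eq X card_R D.m_pos by simp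
    then show ?thesis
      using \<open>int (card F) = _\<close> \<open>k \<le> 5\<close> \<open>a = 2 * int m\<close> \<open>a \<ge> r + 8\<close> by linarith
  qed
  ultimately show ?thesis by blast
qed

end
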